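(* Every finite set $\mathcal{R}$ of connected linear existential rules is a finite unification set: for every union of conjunctive queries $\mathcal{Q}$ there exists a finite union of conjunctive queries $\mathcal{Q}'$ which is a complete UCQ-rewriting of $\mathcal{Q}$ with respect to $\mathcal{R}$.
   Context: Formulas are function-free first-order formulas over a finite set of predicates and constants. An atom is $p(t_1,\ldots,t_n)$ with terms being constants or variables. A conjunctive query (CQ) is a finite set of atoms read as their conjunction with all variables existentially quantified (a Boolean query); a fact base $\mathcal{D}$ is likewise a finite set of atoms with existentially quantified variables. A union of conjunctive queries (UCQ) is a finite disjunction of CQs. An existential rule is a closed formula $\forall \vec X\,\exists \vec Y\; B\rightarrow H$ where the body $B$ and head $H$ are finite sets (conjunctions) of atoms, $\vec X=\mathrm{vars}(B)$ and $\vec Y=\mathrm{vars}(H)\setminus\mathrm{vars}(B)$. For a set of atoms $F$: two variables are connected if some atom of $F$ contains both, or (transitively) if some variable of $F$ is connected to both; $F$ splits into connected components, i.e., maximal subsets whose variables are pairwise connected (atoms with only constants form their own components). An existential rule $B\rightarrow H$ is connected linear if every atom $h\in H$ either contains no variable of $B$, or contains variables from exactly one connected component of $B$ and that connected component consists of a single atom. A UCQ $\mathcal{Q}'$ is a complete UCQ-rewriting of a UCQ $\mathcal{Q}$ with respect to a set of rules $\mathcal{R}$ if for every fact base $\mathcal{D}$: $\mathcal{D}\models\mathcal{Q}'$ iff $\mathcal{R},\mathcal{D}\models\mathcal{Q}$. A set of rules is a finite unification set (fus) if every UCQ has a finite complete UCQ-rewriting with respect to it. *)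

theory Defs
  imports "HOL-Analysis.Finite_Cartesian_Product"
begin

section \<open>Syntax\<close>

datatype 'c fo_term = Var nat | Const 'c

datatype ('p, 'c) atom = Atom (pred: 'p) (args: "'c fo_term list")

record ('p, 'c) signature =
  preds :: "'p set"
  constants :: "'c set"
  arity :: "'p \<Rightarrow> nat"

definition finite_signature :: "('p, 'c) signature \<Rightarrow> bool" where
  "finite_signature \<Sigma> \<longleftrightarrow> finite (preds \<Sigma>) \<and> finite (constants \<Sigma>)"

definition term_vars :: "'c fo_term \<Rightarrow> nat set" where
  "term_vars t = {x. t = Var x}"

definition atom_vars :: "('p, 'c) atom \<Rightarrow> nat set" where
  "atom_vars a = (\<Union>t\<in>set (args a). term_vars t)"

definition vars :: "('p, 'c) atom set \<Rightarrow> nat set" where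
  "vars F = (\<Union>a\<in>F. atom_vars a)"

definition term_over :: "('p, 'c) signature \<Rightarrow> 'c fo_term \<Rightarrow> bool" where
  "term_over \<Sigma> t \<longleftrightarrow> (\<forall>c. t = Const c \<longrightarrow> c \<in> constants \<Sigma>)"

definition atom_over :: "('p, 'c) signature \<Rightarrow> ('p, 'c) atom \<Rightarrow> bool" where
  "atom_over \<Sigma> a \<longleftrightarrow> pred a \<in> preds \<Sigma> \<and> length (args a) = arity \<Sigma> (pred a)
     \<and> (\<forall>t\<in>set (args a). term_over \<Sigma> t)"

definition atoms_over :: "('p, 'c) signature \<Rightarrow> ('p, 'c) atom set \<Rightarrow> bool" where
  "atoms_over \<Sigma> F \<longleftrightarrow> finite F \<and> (\<forall>a\<in>F. atom_over \<Sigma> a)"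

text \<open>
  Conjunctive queries and fact bases are both finite atom sets whose variables are implicitly
  existentially quantified. The empty conjunction (true) and the empty union (false) are allowed.
\<close>

type_synonym ('p, 'c) cq = "('p, 'c) atom set"
type_synonym ('p, 'c) fact_base = "('p, 'c) atom set"
type_synonym ('p, 'c) ucq = "('p, 'c) cq set"

definition cq_over :: "('p, 'c) signature \<Rightarrow> ('p, 'c) cq \<Rightarrow> bool" where
  "cq_over \<Sigma> q \<longleftrightarrow> atoms_over \<Sigma> q"

definition fact_base_over :: "('p, 'c) signature \<Rightarrow> ('p, 'c) fact_base \<Rightarrow> bool" where
  "fact_base_over \<Sigma> D \<longleftrightarrow> atoms_over \<Sigma> D"

definition ucq_over :: "('p, 'c) signature \<Rightarrow> ('p, 'c) ucq \<Rightarrow> bool" where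
  "ucq_over \<Sigma> Q \<longleftrightarrow> finite Q \<and> (\<forall>q\<in>Q. cq_over \<Sigma> q)"

datatype ('p, 'c) erule = Rule (body: "('p, 'c) atom set") (head: "('p, 'c) atom set")

definition rule_over :: "('p, 'c) signature \<Rightarrow> ('p, 'c) erule \<Rightarrow> bool" where
  "rule_over \<Sigma> r \<longleftrightarrow> atoms_over \<Sigma> (body r) \<and> atoms_over \<Sigma> (head r)"

definition ex_vars :: "('p, 'c) erule \<Rightarrow> nat set" where
  "ex_vars r = vars (head r) - vars (body r)"


section \<open>Connected linear rules\<close>

inductive var_connected :: "('p, 'c) atom set \<Rightarrow> nat \<Rightarrow> nat \<Rightarrow> bool" for F where
  share: "a \<in> F \<Longrightarrow> x \<in> atom_vars a \<Longrightarrow> y \<in> atom_vars a \<Longrightarrow> var_connected F x y"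
| step: "var_connected F x z \<Longrightarrow> var_connected F z y \<Longrightarrow> var_connected F x y"

definition pairwise_connected :: "('p, 'c) atom set \<Rightarrow> ('p, 'c) atom set \<Rightarrow> bool" where
  "pairwise_connected F C \<longleftrightarrow> (\<forall>x\<in>vars C. \<forall>y\<in>vars C. var_connected F x y)"

definition nonground :: "('p, 'c) atom set \<Rightarrow> ('p, 'c) atom set" where
  "nonground F = {a \<in> F. atom_vars a \<noteq> {}}"

text \<open>
  Ground atoms are vacuously pairwise connected to everything, so maximality is taken among the
  non-ground atoms, and every ground atom is a component of its own.
\<close>

definition components :: "('p, 'c) atom set \<Rightarrow> ('p, 'c) atom set set" where
  "components F =
     {C. C \<noteq> {} \<and> C \<subseteq> nonground F \<and> pairwise_connected F C
         \<and> (\<forall>C'. C \<subseteq> C' \<and> C' \<subseteq> nonground F \<and> pairwise_connected F C' \<longrightarrow> C' = C)}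
     \<union> {{a} |a. a \<in> F \<and> atom_vars a = {}}"

definition connected_linear :: "('p, 'c) erule \<Rightarrow> bool" where
  "connected_linear r \<longleftrightarrow>
     (\<forall>h\<in>head r. atom_vars h \<inter> vars (body r) = {}
        \<or> (\<exists>b. {C \<in> components (body r). atom_vars h \<inter> vars C \<noteq> {}} = {{b}}))"


section \<open>First-order semantics\<close>

record ('d, 'p, 'c) interp =
  universe :: "'d set"
  const_val :: "'c \<Rightarrow> 'd"
  pred_val :: "'p \<Rightarrow> 'd list set"

definition is_interp :: "('d, 'p, 'c) interp \<Rightarrow> bool" where
  "is_interp I \<longleftrightarrow> universe I \<noteq> {} \<and> range (const_val I) \<subseteq> universe I"

definition valuation :: "('d, 'p, 'c) interp \<Rightarrow> (nat \<Rightarrow> 'd) \<Rightarrow> bool" where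
  "valuation I s \<longleftrightarrow> range s \<subseteq> universe I"

fun term_val :: "('d, 'p, 'c) interp \<Rightarrow> (nat \<Rightarrow> 'd) \<Rightarrow> 'c fo_term \<Rightarrow> 'd" where
  "term_val I s (Var x) = s x"
| "term_val I s (Const c) = const_val I c"

definition holds :: "('d, 'p, 'c) interp \<Rightarrow> (nat \<Rightarrow> 'd) \<Rightarrow> ('p, 'c) atom set \<Rightarrow> bool" where
  "holds I s F \<longleftrightarrow> (\<forall>a\<in>F. map (term_val I s) (args a) \<in> pred_val I (pred a))"

definition sat_ex :: "('d, 'p, 'c) interp \<Rightarrow> ('p, 'c) atom set \<Rightarrow> bool" where
  "sat_ex I F \<longleftrightarrow> (\<exists>s. valuation I s \<and> holds I s F)"

definition sat_ucq :: "('d, 'p, 'c) interp \<Rightarrow> ('p, 'c) ucq \<Rightarrow> bool" where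
  "sat_ucq I Q \<longleftrightarrow> (\<exists>q\<in>Q. sat_ex I q)"

definition sat_rule :: "('d, 'p, 'c) interp \<Rightarrow> ('p, 'c) erule \<Rightarrow> bool" where
  "sat_rule I r \<longleftrightarrow>
     (\<forall>s. valuation I s \<longrightarrow>
        (\<exists>s'. valuation I s' \<and> (\<forall>x. x \<notin> ex_vars r \<longrightarrow> s' x = s x)
              \<and> (holds I s' (body r) \<longrightarrow> holds I s' (head r))))"

text \<open>
  A definition cannot quantify over all domain types, so entailment ranges over all nonempty
  domains contained in \<^typ>\<open>nat\<close>. Lemma \<open>entails_any_domain\<close> below shows that this is
  entailment over arbitrary domains of arbitrary type.
\<close>

definition entails :: "('p, 'c) erule set \<Rightarrow> ('p, 'c) fact_base \<Rightarrow> ('p, 'c) ucq \<Rightarrow> bool" where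
  "entails R D Q \<longleftrightarrow>
     (\<forall>I :: (nat, 'p, 'c) interp.
        is_interp I \<and> (\<forall>r\<in>R. sat_rule I r) \<and> sat_ex I D \<longrightarrow> sat_ucq I Q)"


section \<open>Rewritings\<close>

definition complete_rewriting ::
  "('p, 'c) signature \<Rightarrow> ('p, 'c) erule set \<Rightarrow> ('p, 'c) ucq \<Rightarrow> ('p, 'c) ucq \<Rightarrow> bool" where
  "complete_rewriting \<Sigma> R Q Q' \<longleftrightarrow>
     (\<forall>D. fact_base_over \<Sigma> D \<longrightarrow> (entails {} D Q' \<longleftrightarrow> entails R D Q))"

definition fus :: "('p, 'c) signature \<Rightarrow> ('p, 'c) erule set \<Rightarrow> bool" where
  "fus \<Sigma> R \<longleftrightarrow>
     (\<forall>Q. ucq_over \<Sigma> Q \<longrightarrow> (\<exists>Q'. ucq_over \<Sigma> Q' \<and> complete_rewriting \<Sigma> R Q Q'))"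


section \<open>Entailment does not depend on the choice of domains\<close>

lemma finite_atom_vars: "finite (atom_vars (a :: ('p, 'c) atom))"
proof -
  have "finite (term_vars t)" for t :: "'c fo_term"
    by (cases t) (auto simp: term_vars_def)
  then show ?thesis by (simp add: atom_vars_def)
qed

lemma finite_vars: "finite F \<Longrightarrow> finite (vars F)"
  by (simp add: vars_def finite_atom_vars)

lemma holds_cong:
  assumes "\<And>x. x \<in> vars F \<Longrightarrow> s x = s' x"
  shows "holds I s F = holds I s' F"
proof -
  have "map (term_val I s) (args a) = map (term_val I s') (args a)" if "a \<in> F" for a
  proof (rule map_cong[OF refl])
    fix t assume t: "t \<in> set (args a)"
    show "term_val I s t = term_val I s' t"
    proof (cases t)
      case (Var x)
      then have "x \<in> vars F"
        using \<open>a \<in> F\<close> t by (auto simp: vars_def atom_vars_def term_vars_def)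
      then show ?thesis using Var assms by simp
    qed simp
  qed
  then show ?thesis unfolding holds_def by metis
qed

text \<open>A downward Loewenheim-Skolem argument: pass to a countable submodel.\<close>

lemma countable_submodel:
  fixes I :: "('d, 'p, 'c) interp"
  assumes "is_interp I" and "finite R" and R: "\<forall>r\<in>R. rule_over \<Sigma> r \<and> sat_rule I r"
    and "countable A" and "A \<subseteq> universe I"
  obtains S where "countable S" "A \<subseteq> S" "S \<subseteq> universe I" "S \<noteq> {}"
    "\<forall>r\<in>R. \<forall>s. range s \<subseteq> S \<longrightarrow> holds I s (body r) \<longrightarrow>
       (\<exists>s'. range s' \<subseteq> S \<and> (\<forall>x. x \<notin> ex_vars r \<longrightarrow> s' x = s x) \<and> holds I s' (head r))"
proof -
  obtain d where d: "d \<in> universe I" using assms(1) by (auto simp: is_interp_def)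
  define W where "W r s = (SOME s'. range s' \<subseteq> universe I \<and> (\<forall>x\<in>vars (body r). s' x = s x)
      \<and> holds I s' (head r))" for r :: "('p, 'c) erule" and s :: "nat \<Rightarrow> 'd"
  have W: "range (W r s) \<subseteq> universe I \<and> (\<forall>x\<in>vars (body r). W r s x = s x) \<and> holds I (W r s) (head r)"
    if "r \<in> R" "s ` vars (body r) \<subseteq> universe I" "holds I s (body r)" for r s
  proof -
    define t where "t x = (if x \<in> vars (body r) then s x else d)" for x
    have "valuation I t" using that(2) d by (auto simp: t_def valuation_def)
    with R that(1) obtain s' where s': "valuation I s'" "\<forall>x. x \<notin> ex_vars r \<longrightarrow> s' x = t x"
      "holds I s' (body r) \<longrightarrow> holds I s' (head r)" unfolding sat_rule_def by blast
    have eq: "\<forall>x\<in>vars (body r). s' x = s x" using s'(2) by (auto simp: ex_vars_def t_def)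
    then have "holds I s' (body r)" using that(3) holds_cong[of "body r" s' s I] by auto
    with s' eq have "range s' \<subseteq> universe I \<and> (\<forall>x\<in>vars (body r). s' x = s x) \<and> holds I s' (head r)"
      by (simp add: valuation_def)
    then show ?thesis unfolding W_def
      by (rule someI[where P = "\<lambda>s'. range s' \<subseteq> universe I \<and> (\<forall>x\<in>vars (body r). s' x = s x)
            \<and> holds I s' (head r)"])
  qed
  define N where "N S = S \<union> (\<Union>r\<in>R. \<Union>s\<in>{s \<in> vars (body r) \<rightarrow>\<^sub>E S. holds I s (body r)}. range (W r s))"
    for S
  define T where "T n = (N ^^ n) (insert d A)" for n
  have T_Suc: "T (Suc n) = N (T n)" for n by (simp add: T_def)
  have cT: "countable (T n) \<and> T n \<subseteq> universe I" for n
  proof (induction n)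
    case 0 then show ?case using assms d by (auto simp: T_def)
  next
    case (Suc n)
    have "countable (N (T n))" unfolding N_def
    proof (intro countable_Un countable_UN)
      show "countable (T n)" using Suc by blast
      show "countable R" using \<open>finite R\<close> by (rule countable_finite)
      fix r assume "r \<in> R"
      then have "finite (vars (body r))" using R by (auto simp: rule_over_def atoms_over_def finite_vars)
      then have "countable (vars (body r) \<rightarrow>\<^sub>E T n)" using Suc by (intro countable_PiE) auto
      then show "countable {s \<in> vars (body r) \<rightarrow>\<^sub>E T n. holds I s (body r)}"
        by (rule countable_subset[rotated]) auto
    qed auto
    moreover have "N (T n) \<subseteq> universe I"
    proof -
      have "range (W r s) \<subseteq> universe I"
        if "r \<in> R" "s \<in> vars (body r) \<rightarrow>\<^sub>E T n" "holds I s (body r)" for r s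
      proof -
        have "s ` vars (body r) \<subseteq> universe I" using that(2) Suc by (auto simp: PiE_def Pi_def)
        then show ?thesis using W that by blast
      qed
      then show ?thesis using Suc unfolding N_def by blast
    qed
    ultimately show ?case by (simp add: T_Suc)
  qed
  have mono: "T m \<subseteq> T n" if "m \<le> n" for m n
    by (rule lift_Suc_mono_le[OF _ that]) (auto simp: T_Suc N_def)
  define S where "S = (\<Union>n. T n)"
  have T0: "insert d A \<subseteq> S" unfolding S_def using T_def[of 0] by auto
  have closed: "\<exists>s'. range s' \<subseteq> S \<and> (\<forall>x. x \<notin> ex_vars r \<longrightarrow> s' x = s x) \<and> holds I s' (head r)"
    if r: "r \<in> R" and s: "range s \<subseteq> S" and h: "holds I s (body r)" for r s
  proof -
    define b where "b = vars (body r)"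
    have "finite (s ` b)" using R r by (auto simp: b_def rule_over_def atoms_over_def finite_vars)
    moreover have "s ` b \<subseteq> S" using s by auto
    ultimately have "\<exists>n. s ` b \<subseteq> T n"
    proof (induction rule: finite_induct)
      case (insert y Y)
      then obtain n m where "Y \<subseteq> T n" "y \<in> T m" unfolding S_def by auto
      then have "insert y Y \<subseteq> T (max n m)" using mono[of n "max n m"] mono[of m "max n m"] by auto
      then show ?case by blast
    qed simp
    then obtain n where n: "s ` b \<subseteq> T n" by blast
    define t where "t = restrict s b"
    have t: "t \<in> b \<rightarrow>\<^sub>E T n" using n by (auto simp: t_def)
    have ht: "holds I t (body r)" using h holds_cong[of "body r" t s I] by (simp add: t_def b_def)
    have "range (W r t) \<subseteq> T (Suc n)" unfolding T_Suc N_def using r t ht unfolding b_def by blast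
    then have rS: "range (W r t) \<subseteq> S" unfolding S_def by blast
    have "t ` b \<subseteq> universe I" using t cT[of n] by (auto simp: PiE_def Pi_def)
    then have Wt: "\<forall>x\<in>b. W r t x = s x" "holds I (W r t) (head r)"
      using W[of r t] r ht by (auto simp: b_def t_def)
    define s' where "s' x = (if x \<in> ex_vars r then W r t x else s x)" for x
    have "holds I s' (head r)"
      using Wt holds_cong[of "head r" s' "W r t" I] by (auto simp: s'_def ex_vars_def b_def)
    moreover have "range s' \<subseteq> S" using rS s by (auto simp: s'_def)
    ultimately show ?thesis by (intro exI[of _ s']) (auto simp: s'_def)
  qed
  show ?thesis
  proof (rule that[of S])
    show "countable S" unfolding S_def using cT by auto
    show "S \<subseteq> universe I" unfolding S_def using cT by auto
  qed (use T0 closed in auto)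
qed

lemma entails_any_domain:
  fixes I :: "('d, 'p, 'c) interp"
  assumes "finite_signature \<Sigma>" and "finite R" and R: "\<forall>r\<in>R. rule_over \<Sigma> r"
    and D: "fact_base_over \<Sigma> D" and Q: "ucq_over \<Sigma> Q" and E: "entails R D Q"
    and I: "is_interp I" "\<forall>r\<in>R. sat_rule I r" "sat_ex I D"
  shows "sat_ucq I Q"
proof -
  obtain s0 where s0: "range s0 \<subseteq> universe I" "holds I s0 D"
    using I(3) by (auto simp: sat_ex_def valuation_def)
  define A where "A = const_val I ` constants \<Sigma> \<union> range s0"
  have cA: "countable A" using assms(1) by (auto simp: A_def finite_signature_def countable_finite)
  have AI: "A \<subseteq> universe I" using I(1) s0 by (auto simp: A_def is_interp_def)
  have RI: "\<forall>r\<in>R. rule_over \<Sigma> r \<and> sat_rule I r" using R I(2) by blast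
  obtain S where S: "countable S" "A \<subseteq> S" "S \<subseteq> universe I" "S \<noteq> {}"
    and cl: "\<forall>r\<in>R. \<forall>s. range s \<subseteq> S \<longrightarrow> holds I s (body r) \<longrightarrow>
       (\<exists>s'. range s' \<subseteq> S \<and> (\<forall>x. x \<notin> ex_vars r \<longrightarrow> s' x = s x) \<and> holds I s' (head r))"
    by (rule countable_submodel[OF I(1) \<open>finite R\<close> RI cA AI])
  obtain d where d: "d \<in> S" using S(4) by blast
  define f where "f = to_nat_on S"
  define g where "g = inv_into S f"
  have gf: "g (f x) = x" if "x \<in> S" for x
    using that inj_on_to_nat_on[OF S(1)] by (simp add: f_def g_def)
  define J :: "(nat, 'p, 'c) interp" where
    "J = \<lparr>universe = f ` S, const_val = (\<lambda>c. f (if c \<in> constants \<Sigma> then const_val I c else d)),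
          pred_val = (\<lambda>p. {xs. map g xs \<in> pred_val I p})\<rparr>"
  have KS: "const_val I c \<in> S" if "c \<in> constants \<Sigma>" for c using that S(2) by (auto simp: A_def)
  have J: "is_interp J" using KS d by (auto simp: is_interp_def J_def)
  have hJ: "holds J s F = holds I (g \<circ> s) F" if F: "atoms_over \<Sigma> F" for s F
  proof -
    have "map g (map (term_val J s) (args a)) = map (term_val I (g \<circ> s)) (args a)" if "a \<in> F" for a
    proof -
      have "g (term_val J s t) = term_val I (g \<circ> s) t" if t: "t \<in> set (args a)" for t
      proof (cases t)
        case (Const c)
        then have "c \<in> constants \<Sigma>"
          using F \<open>a \<in> F\<close> t by (auto simp: atoms_over_def atom_over_def term_over_def)
        then show ?thesis using Const gf KS by (simp add: J_def)
      qed simp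
      then show ?thesis by simp
    qed
    moreover have "xs \<in> pred_val J p \<longleftrightarrow> map g xs \<in> pred_val I p" for xs p by (simp add: J_def)
    ultimately show ?thesis unfolding holds_def by metis
  qed
  have gS: "range (g \<circ> s) \<subseteq> S" if "valuation J s" for s
  proof
    fix y assume "y \<in> range (g \<circ> s)"
    then obtain x where "y = g (s x)" by auto
    moreover have "s x \<in> f ` S" using that by (auto simp: valuation_def J_def)
    ultimately show "y \<in> S" using gf by auto
  qed
  have "sat_rule J r" if r: "r \<in> R" for r
    unfolding sat_rule_def
  proof (intro allI impI)
    fix s assume s: "valuation J s"
    have ro: "atoms_over \<Sigma> (body r)" "atoms_over \<Sigma> (head r)" using R r by (auto simp: rule_over_def)
    show "\<exists>s'. valuation J s' \<and> (\<forall>x. x \<notin> ex_vars r \<longrightarrow> s' x = s x)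
        \<and> (holds J s' (body r) \<longrightarrow> holds J s' (head r))"
    proof (cases "holds J s (body r)")
      case True
      then have "holds I (g \<circ> s) (body r)" using hJ ro by blast
      then obtain s' where s': "range s' \<subseteq> S" "\<forall>x. x \<notin> ex_vars r \<longrightarrow> s' x = (g \<circ> s) x"
        "holds I s' (head r)" using cl r gS[OF s] by blast
      define u where "u x = (if x \<in> ex_vars r then f (s' x) else s x)" for x
      have "g \<circ> u = s'" using s'(1,2) gf by (fastforce simp: u_def)
      then have "holds J u (head r)" using hJ[OF ro(2)] s'(3) by simp
      moreover have "valuation J u"
      proof -
        have "s x \<in> f ` S" "s' x \<in> S" for x
          using s s'(1) by (auto simp: valuation_def J_def)
        then have "u x \<in> f ` S" for x by (simp add: u_def)
        then show ?thesis by (auto simp: valuation_def J_def)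
      qed
      ultimately show ?thesis by (intro exI[of _ u]) (auto simp: u_def)
    qed (use s in blast)
  qed
  moreover have "sat_ex J D"
  proof -
    have "g \<circ> (f \<circ> s0) = s0" using gf S(2) by (fastforce simp: A_def)
    moreover have "valuation J (f \<circ> s0)" using S(2) by (auto simp: valuation_def J_def A_def)
    ultimately show ?thesis
      unfolding sat_ex_def using hJ[of D "f \<circ> s0"] s0(2) D by (auto simp: fact_base_over_def)
  qed
  ultimately have "sat_ucq J Q" using E J unfolding entails_def by blast
  then obtain q s where q: "q \<in> Q" "valuation J s" "holds J s q"
    by (auto simp: sat_ucq_def sat_ex_def)
  then have "holds I (g \<circ> s) q" using hJ[of q s] Q by (auto simp: ucq_over_def cq_over_def)
  moreover have "valuation I (g \<circ> s)" using gS[OF q(2)] S(3) by (auto simp: valuation_def)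
  ultimately show ?thesis using q(1) unfolding sat_ucq_def sat_ex_def by blast
qed

end

theory Submission
  imports Defs "HOL-Library.Nat_Bijection"
begin

text \<open>
  Fix a bound \<open>N\<close> on the sizes of the rule bodies and of the disjuncts of the query. The point is
  that entailment is local: whether \<open>R\<close> and \<open>D\<close> entail the query depends only on the conjunctive
  queries with at most \<open>N\<close> atoms that hold in \<open>D\<close>. Indeed, let \<open>M\<close> be a model of \<open>R\<close> in which
  all these queries hold. Then every set of at most \<open>N\<close> atoms of the chase of \<open>D\<close> maps
  homomorphically to \<open>M\<close>, by induction along the chase: replace every new atom by the single body
  atom that carries all its frontier variables, which does not increase the number of atoms, map
  the resulting set to \<open>M\<close>, map the remaining, variable-disjoint part of every body independently
  (it has at most \<open>N\<close> atoms as well), and fire the rules in \<open>M\<close>.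

  Up to renaming there are finitely many queries with at most \<open>N\<close> atoms. The rewriting consists of
  those variable-disjoint conjunctions of them that entail the query.
\<close>

section \<open>Components\<close>

lemma var_connected_sym: "var_connected F x y \<Longrightarrow> var_connected F y x"
  by (induction rule: var_connected.induct) (auto intro: var_connected.intros)

lemma var_in_component:
  assumes "x \<in> vars F"
  shows "\<exists>C\<in>components F. x \<in> vars C"
proof -
  obtain a where a: "a \<in> F" "x \<in> atom_vars a" using assms by (auto simp: vars_def)
  \<comment> \<open>The candidate is the connectivity class of \<open>x\<close>. Connection through
    \<open>x\<close> makes it pairwise connected, and a larger connected set also contains
    \<open>x\<close>, so it stays inside the class.\<close>
  define C where "C = {c \<in> nonground F. \<forall>y\<in>atom_vars c. var_connected F x y}"
  have aC: "a \<in> C" using a by (auto simp: C_def nonground_def intro: var_connected.share)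
  have pc: "pairwise_connected F C"
    unfolding pairwise_connected_def C_def vars_def
    by (auto intro: var_connected.step[OF var_connected_sym])
  have "C' = C" if "C \<subseteq> C'" "C' \<subseteq> nonground F" "pairwise_connected F C'" for C'
  proof
    have x: "x \<in> vars C'" using aC a(2) that(1) by (auto simp: vars_def)
    show "C' \<subseteq> C"
      using that(2,3) x unfolding C_def pairwise_connected_def vars_def by blast
  qed (fact that(1))
  then have "C \<in> components F"
    using aC pc unfolding components_def by (auto simp: C_def)
  then show ?thesis using aC a(2) by (auto simp: vars_def)
qed

text \<open>An atom sharing a variable with \<open>b\<close> could be added to \<open>{b}\<close>,
  against maximality. This later allows \<open>b\<close> to be mapped independently of the rest of
  the body.\<close>

lemma singleton_component_disjoint:
  assumes b: "{b} \<in> components F" and a: "a \<in> F" "a \<noteq> b"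
  shows "atom_vars a \<inter> atom_vars b = {}"
proof (rule ccontr)
  assume "atom_vars a \<inter> atom_vars b \<noteq> {}"
  then obtain x where x: "x \<in> atom_vars a" "x \<in> atom_vars b" by blast
  have bF: "b \<in> F" and mx: "\<And>C'. b \<in> C' \<Longrightarrow> C' \<subseteq> nonground F \<Longrightarrow> pairwise_connected F C' \<Longrightarrow> C' = {b}"
    using b x(2) unfolding components_def nonground_def by auto
  have "var_connected F y x" if "y \<in> vars {a, b}" for y
    using that x a(1) bF by (auto simp: vars_def intro: var_connected.share)
  then have "pairwise_connected F {a, b}"
    unfolding pairwise_connected_def by (blast intro: var_connected.step var_connected_sym)
  moreover have "{a, b} \<subseteq> nonground F" using a(1) bF x by (auto simp: nonground_def)
  ultimately have "{a, b} = {b}" using mx[of "{a, b}"] by simp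
  with a(2) show False by (simp add: doubleton_eq_iff)
qed

text \<open>Every shared variable lies in a component of the body, and that component meets
  \<open>h\<close>, so it can only be \<open>{b}\<close>. The atom \<open>b\<close> acts as a guard
  for the frontier of \<open>h\<close>.\<close>

lemma connected_linear_frontier:
  assumes "connected_linear r" "h \<in> head r" "atom_vars h \<inter> vars (body r) \<noteq> {}"
  obtains b where "b \<in> body r" "{b} \<in> components (body r)"
    "atom_vars h \<inter> vars (body r) \<subseteq> atom_vars b"
proof -
  obtain b where b: "{C \<in> components (body r). atom_vars h \<inter> vars C \<noteq> {}} = {{b}}"
    using assms unfolding connected_linear_def by blast
  then have c: "{b} \<in> components (body r)" by blast
  then have "b \<in> body r" by (auto simp: components_def nonground_def)
  moreover have "atom_vars h \<inter> vars (body r) \<subseteq> atom_vars b"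
  proof
    fix x assume x: "x \<in> atom_vars h \<inter> vars (body r)"
    then obtain C where "C \<in> components (body r)" "x \<in> vars C"
      using var_in_component by blast
    then have "C = {b}" using b x by blast
    then show "x \<in> atom_vars b" using \<open>x \<in> vars C\<close> by (simp add: vars_def)
  qed
  ultimately show ?thesis using c that by blast
qed

section \<open>The chase\<close>

text \<open>A null invented by a rule carries the whole trigger, so nulls of different triggers differ.\<close>

datatype ('p, 'c) gterm =
  Null nat | Sym 'c | Skolem "('p, 'c) erule" nat "nat \<Rightarrow> ('p, 'c) gterm"

fun gval :: "(nat \<Rightarrow> ('p, 'c) gterm) \<Rightarrow> 'c fo_term \<Rightarrow> ('p, 'c) gterm" where
  "gval \<sigma> (Var x) = \<sigma> x"
| "gval \<sigma> (Const c) = Sym c"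

definition inst ::
  "(nat \<Rightarrow> ('p, 'c) gterm) \<Rightarrow> ('p, 'c) atom \<Rightarrow> 'p \<times> ('p, 'c) gterm list" where
  "inst \<sigma> a = (pred a, map (gval \<sigma>) (args a))"

definition skolem_ext ::
  "('p, 'c) erule \<Rightarrow> (nat \<Rightarrow> ('p, 'c) gterm) \<Rightarrow> nat \<Rightarrow> ('p, 'c) gterm" where
  "skolem_ext r \<sigma> x = (if x \<in> ex_vars r then Skolem r x \<sigma> else \<sigma> x)"

text \<open>The oblivious chase in parallel rounds: a trigger that fires again recreates the same
  nulls, so repetition adds nothing.\<close>

primrec chase ::
  "('p, 'c) erule set \<Rightarrow> ('p, 'c) atom set \<Rightarrow> nat \<Rightarrow> ('p \<times> ('p, 'c) gterm list) set" where
  "chase R D 0 = inst Null ` D"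
| "chase R D (Suc n) = chase R D n \<union>
     {inst (skolem_ext r \<sigma>) h | r \<sigma> h. r \<in> R \<and> inst \<sigma> ` body r \<subseteq> chase R D n \<and> h \<in> head r}"

definition gterms :: "('p \<times> ('p, 'c) gterm list) set \<Rightarrow> ('p, 'c) gterm set" where
  "gterms A = (\<Union>(p, ts)\<in>A. set ts)"

definition chase_interp ::
  "('p, 'c) erule set \<Rightarrow> ('p, 'c) atom set \<Rightarrow> (('p, 'c) gterm, 'p, 'c) interp" where
  "chase_interp R D =
     \<lparr>universe = UNIV, const_val = Sym, pred_val = (\<lambda>p. {ts. \<exists>n. (p, ts) \<in> chase R D n})\<rparr>"

lemma chase_mono: "m \<le> n \<Longrightarrow> chase R D m \<subseteq> chase R D n"
  by (rule lift_Suc_mono_le) auto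

lemma finite_subset_chase:
  assumes "finite A" "A \<subseteq> (\<Union>n. chase R D n)"
  shows "\<exists>n. A \<subseteq> chase R D n"
  using assms
proof (induction rule: finite_induct)
  case (insert a A)
  then obtain m n where "a \<in> chase R D m" "A \<subseteq> chase R D n" by auto
  then have "insert a A \<subseteq> chase R D (max m n)"
    using chase_mono[of m "max m n"] chase_mono[of n "max m n"] by fastforce
  then show ?case by blast
qed simp

lemma term_val_chase_interp: "term_val (chase_interp R D) \<sigma> = gval \<sigma>"
proof
  show "term_val (chase_interp R D) \<sigma> t = gval \<sigma> t" for t
    by (cases t) (auto simp: chase_interp_def)
qed

lemma holds_chase_interp:
  "holds (chase_interp R D) \<sigma> F \<longleftrightarrow> inst \<sigma> ` F \<subseteq> (\<Union>n. chase R D n)"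
  unfolding holds_def term_val_chase_interp by (auto simp: chase_interp_def inst_def)

lemma gval_in_gterms:
  assumes "inst \<sigma> ` F \<subseteq> A" "x \<in> vars F"
  shows "\<sigma> x \<in> gterms A"
proof -
  obtain a where a: "a \<in> F" "Var x \<in> set (args a)"
    using assms(2) by (auto simp: vars_def atom_vars_def term_vars_def)
  then have "inst \<sigma> a \<in> A" using assms(1) by blast
  moreover have "\<sigma> x \<in> set (map (gval \<sigma>) (args a))" using a(2) by force
  ultimately show ?thesis unfolding gterms_def inst_def by blast
qed

lemma inst_cong:
  assumes "\<And>x. x \<in> atom_vars a \<Longrightarrow> \<sigma> x = \<tau> x"
  shows "inst \<sigma> a = inst \<tau> a"
proof -
  have "gval \<sigma> t = gval \<tau> t" if "t \<in> set (args a)" for t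
  proof (cases t)
    case (Var x)
    then have "x \<in> atom_vars a" using that by (auto simp: atom_vars_def term_vars_def)
    then show ?thesis using Var assms by simp
  qed simp
  then show ?thesis by (simp add: inst_def)
qed

lemma inst_skolem_ext_body:
  "b \<in> body r \<Longrightarrow> inst (skolem_ext r \<sigma>) b = inst \<sigma> b"
  by (rule inst_cong) (auto simp: skolem_ext_def ex_vars_def vars_def)

text \<open>In the round where a null first appears it cannot be the value of a body variable, so it
  comes from an existential variable. Injectivity of \<open>Skolem\<close> then identifies rule and
  trigger, and that round adds the whole instantiated head.\<close>

lemma skolem_fired:
  assumes "Skolem r x \<sigma> \<in> gterms (chase R D n)" "h \<in> head r"
  shows "inst (skolem_ext r \<sigma>) h \<in> chase R D n"
  using assms(1)
proof (induction n)
  case 0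
  have "Skolem r x \<sigma> \<noteq> gval Null t" for t :: "'b fo_term" by (cases t) auto
  with 0 show ?case by (auto simp: gterms_def inst_def)
next
  case (Suc n)
  show ?case
  proof (cases "Skolem r x \<sigma> \<in> gterms (chase R D n)")
    case True
    then show ?thesis using Suc.IH by simp
  next
    case False
    then obtain r' \<tau> h' t where r': "r' \<in> R" "inst \<tau> ` body r' \<subseteq> chase R D n" "h' \<in> head r'"
      and t: "t \<in> set (args h')" "Skolem r x \<sigma> = gval (skolem_ext r' \<tau>) t"
      using Suc.prems by (fastforce simp: gterms_def inst_def)
    obtain y where y: "t = Var y" using t(2) by (cases t) auto
    have yh: "y \<in> vars (head r')"
      using t(1) y r'(3) by (auto simp: vars_def atom_vars_def term_vars_def)
    have "y \<in> ex_vars r'"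
    proof (rule ccontr)
      assume n: "y \<notin> ex_vars r'"
      then have "y \<in> vars (body r')" using yh by (simp add: ex_vars_def)
      then have "\<tau> y \<in> gterms (chase R D n)" using gval_in_gterms r'(2) by blast
      then show False using False t(2) y n by (simp add: skolem_ext_def)
    qed
    then have "r' = r" "\<tau> = \<sigma>" using t(2) y by (auto simp: skolem_ext_def)
    then show ?thesis using r' assms(2) by auto
  qed
qed

lemma chase_interp_model:
  assumes "\<forall>r\<in>R. finite (body r)"
  shows "is_interp (chase_interp R D)" "\<forall>r\<in>R. sat_rule (chase_interp R D) r"
    "sat_ex (chase_interp R D) D"
proof -
  let ?U = "chase_interp R D"
  have val: "valuation ?U s" for s by (simp add: valuation_def chase_interp_def)
  show "is_interp ?U" by (simp add: is_interp_def chase_interp_def)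
  show "\<forall>r\<in>R. sat_rule ?U r"
    unfolding sat_rule_def
  proof (intro ballI allI impI)
    fix r s assume r: "r \<in> R"
    have "holds ?U (skolem_ext r s) (head r)" if "holds ?U (skolem_ext r s) (body r)"
    proof -
      have "inst s ` body r \<subseteq> (\<Union>n. chase R D n)"
        using that unfolding holds_chase_interp by (auto simp: inst_skolem_ext_body)
      then obtain n where "inst s ` body r \<subseteq> chase R D n"
        using finite_subset_chase[of "inst s ` body r"] assms r by blast
      then have "inst (skolem_ext r s) ` head r \<subseteq> chase R D (Suc n)" using r by auto
      then show ?thesis unfolding holds_chase_interp by blast
    qed
    then show "\<exists>s'. valuation ?U s' \<and> (\<forall>x. x \<notin> ex_vars r \<longrightarrow> s' x = s x) \<and>
        (holds ?U s' (body r) \<longrightarrow> holds ?U s' (head r))"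
      using val by (intro exI[of _ "skolem_ext r s"]) (auto simp: skolem_ext_def)
  qed
  have "inst Null ` D \<subseteq> (\<Union>n. chase R D n)" using chase.simps(1)[of R D] by blast
  then show "sat_ex ?U D" unfolding sat_ex_def using val holds_chase_interp by blast
qed

section \<open>Locality\<close>

text \<open>Values are constrained on all terms, even those outside \<open>A\<close>, so that
  \<open>g \<circ> \<sigma>\<close> is a valuation for every substitution
  \<open>\<sigma>\<close>.\<close>

definition ghom ::
  "('d, 'p, 'c) interp \<Rightarrow> (('p, 'c) gterm \<Rightarrow> 'd) \<Rightarrow> ('p \<times> ('p, 'c) gterm list) set \<Rightarrow> bool" where
  "ghom M g A \<longleftrightarrow> range g \<subseteq> universe M \<and> (\<forall>c. g (Sym c) = const_val M c)
     \<and> (\<forall>(p, ts)\<in>A. map g ts \<in> pred_val M p)"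

lemma ghom_inst:
  assumes "\<And>c. g (Sym c) = const_val M c"
  shows "map g (map (gval \<sigma>) (args a)) = map (term_val M (g \<circ> \<sigma>)) (args a)"
proof -
  have "g (gval \<sigma> t) = term_val M (g \<circ> \<sigma>) t" for t using assms by (cases t) auto
  then show ?thesis by simp
qed

lemma ghom_holds:
  assumes "\<And>c. g (Sym c) = const_val M c"
  shows "(\<forall>(p, ts)\<in>inst \<sigma> ` F. map g ts \<in> pred_val M p) \<longleftrightarrow> holds M (g \<circ> \<sigma>) F"
  unfolding holds_def by (auto simp: inst_def ghom_inst[OF assms] simp del: map_map)

text \<open>The invariant of the induction along the chase. Different subsets may be served by
  unrelated homomorphisms; none is claimed for \<open>A\<close> as a whole.\<close>

definition local_in ::
  "('d, 'p, 'c) interp \<Rightarrow> nat \<Rightarrow> ('p \<times> ('p, 'c) gterm list) set \<Rightarrow> bool" where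
  "local_in M N A \<longleftrightarrow> (\<forall>B \<subseteq> A. finite B \<and> card B \<le> N \<longrightarrow> (\<exists>g. ghom M g B))"

lemma local_in_base:
  assumes M: "is_interp M" and "\<And>A. A \<subseteq> D \<Longrightarrow> finite A \<Longrightarrow> card A \<le> N \<Longrightarrow> sat_ex M A"
  shows "local_in M N (inst Null ` D)"
  unfolding local_in_def
proof (intro allI impI)
  fix B assume B: "B \<subseteq> inst Null ` D" "finite B \<and> card B \<le> N"
  obtain A where A: "A \<subseteq> D" "B = inst Null ` A" "inj_on (inst Null) A"
    using B(1) by (meson subset_image_inj)
  then have "finite A" "card A \<le> N" using B(2) by (auto simp: card_image finite_image_iff)
  then obtain s where s: "valuation M s" "holds M s A"
    using assms(2) A(1) unfolding sat_ex_def by blast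
  obtain d where d: "d \<in> universe M" using M by (auto simp: is_interp_def)
  \<comment> \<open>The value \<open>d\<close> is a filler: no Skolem term occurs in the first
    stage.\<close>
  define g where "g t = (case t of Null x \<Rightarrow> s x | Sym c \<Rightarrow> const_val M c | Skolem _ _ _ \<Rightarrow> d)"
    for t :: "('b, 'c) gterm"
  have c: "g (Sym c) = const_val M c" for c by (simp add: g_def)
  have "g \<circ> Null = s" by (auto simp: g_def)
  then have "\<forall>(p, ts)\<in>B. map g ts \<in> pred_val M p"
    using ghom_holds[of g M Null A] c s(2) A(2) by simp
  moreover have "g t \<in> universe M" for t
    using s(1) d M by (cases t) (auto simp: g_def valuation_def is_interp_def)
  ultimately show "\<exists>g. ghom M g B" using c unfolding ghom_def by blast
qed

text \<open>Two maps are glued: \<open>g\<close> on the singleton components whose image lies in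
  \<open>G\<close>, and on the rest of the body some \<open>k\<close> supplied by locality. They
  cannot conflict, since a singleton component shares no variable with other body atoms.\<close>

lemma body_match:
  assumes loc: "local_in M N A" and B: "inst \<sigma> ` body r \<subseteq> A"
    and fin: "finite (body r)" "card (body r) \<le> N" and g: "ghom M g G"
  obtains \<tau> where "valuation M \<tau>" "holds M \<tau> (body r)"
    "\<And>b x. {b} \<in> components (body r) \<Longrightarrow> b \<in> body r \<Longrightarrow> inst \<sigma> b \<in> G \<Longrightarrow> x \<in> atom_vars b \<Longrightarrow> \<tau> x = g (\<sigma> x)"
proof -
  define L where "L = {b \<in> body r. {b} \<in> components (body r) \<and> inst \<sigma> b \<in> G}"
  have "card (inst \<sigma> ` body r) \<le> N" using card_image_le[OF fin(1)] fin(2) order_trans by blast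
  then obtain k where k: "ghom M k (inst \<sigma> ` body r)"
    using loc B fin(1) unfolding local_in_def by blast
  define \<tau> where "\<tau> x = (if x \<in> vars L then g (\<sigma> x) else k (\<sigma> x))" for x
  have "holds M (k \<circ> \<sigma>) (body r)"
    using ghom_holds[of k M \<sigma> "body r"] k unfolding ghom_def by blast
  then have kb: "holds M (k \<circ> \<sigma>) (body r - L)" by (auto simp: holds_def)
  have "inst \<sigma> ` L \<subseteq> G" by (auto simp: L_def)
  then have gb: "holds M (g \<circ> \<sigma>) L"
    using ghom_holds[of g M \<sigma> L] g unfolding ghom_def by blast
  have "x \<notin> vars L" if "x \<in> vars (body r - L)" for x
    using that singleton_component_disjoint[of _ "body r"] by (fastforce simp: vars_def L_def)
  then have "holds M \<tau> (body r - L)"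
    using kb holds_cong[of "body r - L" \<tau> "k \<circ> \<sigma>" M] by (auto simp: \<tau>_def)
  moreover have "holds M \<tau> L"
    using gb holds_cong[of L \<tau> "g \<circ> \<sigma>" M] by (auto simp: \<tau>_def)
  ultimately have "holds M \<tau> (body r)" by (auto simp: holds_def)
  moreover have "valuation M \<tau>" using g k by (auto simp: valuation_def ghom_def \<tau>_def)
  moreover have "\<tau> x = g (\<sigma> x)"
    if "{b} \<in> components (body r)" "b \<in> body r" "inst \<sigma> b \<in> G" "x \<in> atom_vars b" for b x
    using that by (auto simp: \<tau>_def L_def vars_def)
  ultimately show ?thesis using that by blast
qed

lemma local_in_step:
  assumes M: "\<forall>r\<in>R. sat_rule M r"
    and R: "\<forall>r\<in>R. finite (body r) \<and> card (body r) \<le> N \<and> connected_linear r"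
    and loc: "local_in M N (chase R D n)"
  shows "local_in M N (chase R D (Suc n))"
  unfolding local_in_def
proof (intro allI impI)
  fix A assume A: "A \<subseteq> chase R D (Suc n)" "finite A \<and> card A \<le> N"
  let ?F = "chase R D n"
  \<comment> \<open>Replacement of atoms: an old atom stands for itself, a new one is replaced by
    the image of a guard of its frontier in some trigger producing it.\<close>
  define linked where "linked a b \<longleftrightarrow> b \<in> ?F \<and> (a \<in> ?F \<longrightarrow> b = a) \<and> (a \<notin> ?F \<longrightarrow>
     (\<exists>r \<sigma> h c. r \<in> R \<and> inst \<sigma> ` body r \<subseteq> ?F \<and> h \<in> head r \<and> a = inst (skolem_ext r \<sigma>) h
        \<and> b = inst \<sigma> c \<and> c \<in> body r \<and> {c} \<in> components (body r)
        \<and> atom_vars h \<inter> vars (body r) \<subseteq> atom_vars c))" for a b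
  \<comment> \<open>A single link per atom keeps \<open>card G\<close> at most
    \<open>card A\<close>. An atom with no link is dropped; this can only be a new one with empty
    frontier.\<close>
  define G where "G = (\<lambda>a. SOME b. linked a b) ` {a \<in> A. \<exists>b. linked a b}"
  have Gl: "\<exists>b\<in>G. linked a b" if "a \<in> A" "linked a b" for a b
    using that someI[of "linked a" b] unfolding G_def by blast
  have GF: "G \<subseteq> ?F"
  proof
    fix b assume "b \<in> G"
    then obtain a b' where "b = (SOME b. linked a b)" "linked a b'" unfolding G_def by blast
    then have "linked a b" using someI[of "linked a" b'] by simp
    then show "b \<in> ?F" by (simp add: linked_def)
  qed
  have "finite G" using A(2) by (simp add: G_def)
  moreover have "card G \<le> N"
  proof -
    have "card G \<le> card {a \<in> A. \<exists>b. linked a b}" unfolding G_def using A(2) by (intro card_image_le) auto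
    also have "\<dots> \<le> card A" using A(2) by (intro card_mono) auto
    finally show ?thesis using A(2) by simp
  qed
  ultimately obtain g where g: "ghom M g G" using loc GF unfolding local_in_def by blast
  have old: "a \<in> G" if "a \<in> A" "a \<in> ?F" for a
    using Gl[of a a] that by (auto simp: linked_def)

  \<comment> \<open>All guards mapped into \<open>G\<close> are respected at once, because one
    trigger may contribute several head atoms with different guards.\<close>
  define good where "good r \<sigma> \<tau> \<longleftrightarrow> valuation M \<tau> \<and> holds M \<tau> (head r) \<and>
     (\<forall>b x. {b} \<in> components (body r) \<and> b \<in> body r \<and> inst \<sigma> b \<in> G \<and> x \<in> atom_vars b
        \<longrightarrow> \<tau> x = g (\<sigma> x))" for r \<sigma> \<tau>
  have ex: "\<exists>\<tau>. good r \<sigma> \<tau>" if r: "r \<in> R" "inst \<sigma> ` body r \<subseteq> ?F" for r \<sigma>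
  proof -
    obtain \<tau> where \<tau>: "valuation M \<tau>" "holds M \<tau> (body r)"
      "\<And>b x. {b} \<in> components (body r) \<Longrightarrow> b \<in> body r \<Longrightarrow> inst \<sigma> b \<in> G \<Longrightarrow> x \<in> atom_vars b \<Longrightarrow> \<tau> x = g (\<sigma> x)"
      using body_match[OF loc r(2) _ _ g] R r(1) by blast
    obtain \<tau>' where \<tau>': "valuation M \<tau>'" "\<forall>x. x \<notin> ex_vars r \<longrightarrow> \<tau>' x = \<tau> x"
      "holds M \<tau>' (body r) \<longrightarrow> holds M \<tau>' (head r)"
      using M r(1) \<tau>(1) unfolding sat_rule_def by blast
    have eq: "\<tau>' x = \<tau> x" if "x \<in> vars (body r)" for x using \<tau>'(2) that by (simp add: ex_vars_def)
    then have "holds M \<tau>' (head r)"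
      using \<tau>'(3) \<tau>(2) holds_cong[of "body r" \<tau>' \<tau> M] by blast
    moreover have "\<tau>' x = g (\<sigma> x)"
      if "{b} \<in> components (body r)" "b \<in> body r" "inst \<sigma> b \<in> G" "x \<in> atom_vars b" for b x
      using \<tau>(3)[OF that] eq[of x] that by (auto simp: vars_def)
    ultimately show ?thesis using \<tau>'(1) unfolding good_def by blast
  qed
  \<comment> \<open>One valuation per trigger: atoms of \<open>A\<close> created by the same trigger
    may share nulls and must agree on them.\<close>
  define T where "T r \<sigma> = (SOME \<tau>. good r \<sigma> \<tau>)" for r \<sigma>
  have T: "good r \<sigma> (T r \<sigma>)" if "r \<in> R" "inst \<sigma> ` body r \<subseteq> ?F" for r \<sigma>
    unfolding T_def using ex[OF that] by (rule someI_ex)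

  \<comment> \<open>Old terms keep their value under \<open>g\<close>; a fresh null gets the value
    that its own trigger prescribes, which is unambiguous as the null records the trigger.\<close>
  define k where "k t = (case t of
      Skolem r x \<sigma> \<Rightarrow> if t \<notin> gterms ?F \<and> r \<in> R \<and> inst \<sigma> ` body r \<subseteq> ?F then T r \<sigma> x else g t
    | _ \<Rightarrow> g t)" for t
  have kg: "k t = g t" if "t \<in> gterms ?F" for t using that by (auto simp: k_def split: gterm.split)
  have kc: "k (Sym c) = const_val M c" for c using g by (simp add: k_def ghom_def)
  have kr: "k t \<in> universe M" for t
  proof -
    have "g u \<in> universe M" for u using g by (auto simp: ghom_def)
    moreover have "T r \<sigma> x \<in> universe M" if "r \<in> R" "inst \<sigma> ` body r \<subseteq> ?F" for r \<sigma> x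
      using T[OF that] by (auto simp: good_def valuation_def)
    ultimately show ?thesis by (simp add: k_def split: gterm.split)
  qed
  have "map k ts \<in> pred_val M p" if a: "(p, ts) \<in> A" for p ts
  proof (cases "(p, ts) \<in> ?F")
    case True
    have "map k ts = map g ts" using kg True by (force simp: gterms_def)
    moreover have "map g ts \<in> pred_val M p" using old[OF a True] g by (auto simp: ghom_def)
    ultimately show ?thesis by (simp only:)
  next
    case new: False
    then obtain r \<sigma> h where r: "r \<in> R" "inst \<sigma> ` body r \<subseteq> ?F" "h \<in> head r"
      "(p, ts) = inst (skolem_ext r \<sigma>) h"
      using a A(1) by auto
    \<comment> \<open>Another trigger may create the same atom, and the link kept in
      \<open>G\<close> may belong to that one; the trigger is therefore chosen again to fit the
      link.\<close>
    have "\<exists>r \<sigma> h. r \<in> R \<and> inst \<sigma> ` body r \<subseteq> ?F \<and> h \<in> head r \<and> (p, ts) = inst (skolem_ext r \<sigma>) h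
       \<and> (\<forall>x \<in> atom_vars h \<inter> vars (body r). \<exists>b. {b} \<in> components (body r) \<and> b \<in> body r
            \<and> inst \<sigma> b \<in> G \<and> x \<in> atom_vars b)"
    proof (cases "atom_vars h \<inter> vars (body r) = {}")
      case True
      then show ?thesis using r by blast
    next
      case False
      obtain c where c: "c \<in> body r" "{c} \<in> components (body r)"
        "atom_vars h \<inter> vars (body r) \<subseteq> atom_vars c"
        using connected_linear_frontier[OF _ r(3) False] R r(1) by blast
      then have "linked (p, ts) (inst \<sigma> c)" using r new unfolding linked_def by blast
      then obtain b where "b \<in> G" "linked (p, ts) b" using Gl a by blast
      then show ?thesis using new unfolding linked_def by blast
    qed
    then obtain r \<sigma> h where r: "r \<in> R" "inst \<sigma> ` body r \<subseteq> ?F" "h \<in> head r"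
      "(p, ts) = inst (skolem_ext r \<sigma>) h"
      and fr: "\<And>x. x \<in> atom_vars h \<Longrightarrow> x \<in> vars (body r) \<Longrightarrow> \<exists>b. {b} \<in> components (body r) \<and> b \<in> body r
            \<and> inst \<sigma> b \<in> G \<and> x \<in> atom_vars b"
      by blast
    note good = T[OF r(1,2), unfolded good_def]
    have "(k \<circ> skolem_ext r \<sigma>) x = T r \<sigma> x" if x: "x \<in> vars {h}" for x
    proof (cases "x \<in> ex_vars r")
      case True
      \<comment> \<open>A Skolem term occurring in the previous level would mean that the trigger fired earlier.\<close>
      have "Skolem r x \<sigma> \<notin> gterms ?F" using skolem_fired[of r x \<sigma> R D n h] r(3,4) new by auto
      then show ?thesis using True r(1,2) by (simp add: skolem_ext_def k_def)
    next
      case False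
      have xh: "x \<in> atom_vars h" using x by (simp add: vars_def)
      then have xb: "x \<in> vars (body r)" using False r(3) by (auto simp: ex_vars_def vars_def)
      then have "k (\<sigma> x) = g (\<sigma> x)" using kg gval_in_gterms[OF r(2)] by blast
      moreover have "T r \<sigma> x = g (\<sigma> x)" using good fr[OF xh xb] by blast
      ultimately show ?thesis using False by (simp add: skolem_ext_def)
    qed
    then have "holds M (k \<circ> skolem_ext r \<sigma>) {h} \<longleftrightarrow> holds M (T r \<sigma>) {h}" by (rule holds_cong)
    then have "holds M (k \<circ> skolem_ext r \<sigma>) {h}" using good r(3) by (auto simp: holds_def)
    then show ?thesis using ghom_holds[of k M "skolem_ext r \<sigma>" "{h}"] kc r(4)[symmetric] by simp
  qed
  then have "ghom M k A" using kr kc unfolding ghom_def by blast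
  then show "\<exists>g. ghom M g A" by blast
qed

text \<open>The chase satisfies a disjunct of \<open>Q\<close>, whose image has at most
  \<open>N\<close> atoms and therefore maps to \<open>M\<close> by the invariant. The model
  \<open>M\<close> satisfies small subsets of \<open>D\<close> one at a time, perhaps not
  \<open>D\<close> itself.\<close>

lemma locality:
  fixes M :: "('d, 'p, 'c) interp"
  assumes \<Sigma>: "finite_signature \<Sigma>" "finite R" "\<forall>r\<in>R. rule_over \<Sigma> r"
    "fact_base_over \<Sigma> D" "ucq_over \<Sigma> Q"
    and cl: "\<forall>r\<in>R. connected_linear r"
    and N: "\<forall>r\<in>R. card (body r) \<le> N" "\<forall>q\<in>Q. card q \<le> N"
    and E: "entails R D Q"
    and M: "is_interp M" "\<forall>r\<in>R. sat_rule M r"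
    and D: "\<And>A. A \<subseteq> D \<Longrightarrow> finite A \<Longrightarrow> card A \<le> N \<Longrightarrow> sat_ex M A"
  shows "sat_ucq M Q"
proof -
  have fin: "\<forall>r\<in>R. finite (body r)" using \<Sigma>(3) by (auto simp: rule_over_def atoms_over_def)
  have loc: "local_in M N (chase R D n)" for n
  proof (induction n)
    case 0
    show ?case using local_in_base[OF M(1) D] by simp
  next
    case (Suc n)
    show ?case using local_in_step[OF M(2) _ Suc] fin N(1) cl by blast
  qed
  \<comment> \<open>\<open>entails\<close> ranges over domains of naturals, while the chase has
    ground terms as its domain; hence the passage to arbitrary domains.\<close>
  have "sat_ucq (chase_interp R D) Q"
    using entails_any_domain[OF \<Sigma> E] chase_interp_model[OF fin] by blast
  then obtain q s where q: "q \<in> Q" "holds (chase_interp R D) s q"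
    by (auto simp: sat_ucq_def sat_ex_def)
  have fq: "finite q" using \<Sigma>(5) q(1) by (auto simp: ucq_over_def cq_over_def atoms_over_def)
  obtain n where n: "inst s ` q \<subseteq> chase R D n"
    using finite_subset_chase[of "inst s ` q"] q(2) fq unfolding holds_chase_interp by blast
  have "card (inst s ` q) \<le> N" using card_image_le[OF fq] N(2) q(1) order_trans by blast
  then obtain g where g: "ghom M g (inst s ` q)" using loc n fq unfolding local_in_def by blast
  then have "holds M (g \<circ> s) q" using ghom_holds[of g M s q] unfolding ghom_def by blast
  moreover have "valuation M (g \<circ> s)" using g by (auto simp: ghom_def valuation_def)
  ultimately show ?thesis using q(1) unfolding sat_ucq_def sat_ex_def by blast
qed

section \<open>Renaming and conjunction of queries\<close>

fun rename_term :: "(nat \<Rightarrow> nat) \<Rightarrow> 'c fo_term \<Rightarrow> 'c fo_term" where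
  "rename_term f (Var x) = Var (f x)"
| "rename_term f (Const c) = Const c"

definition rename_atom :: "(nat \<Rightarrow> nat) \<Rightarrow> ('p, 'c) atom \<Rightarrow> ('p, 'c) atom" where
  "rename_atom f a = Atom (pred a) (map (rename_term f) (args a))"

lemma atom_over_rename: "atom_over \<Sigma> a \<Longrightarrow> atom_over \<Sigma> (rename_atom f a)"
proof -
  have "term_over \<Sigma> t \<Longrightarrow> term_over \<Sigma> (rename_term f t)" for t
    by (cases t) (auto simp: term_over_def)
  then show "atom_over \<Sigma> a \<Longrightarrow> ?thesis" by (auto simp: atom_over_def rename_atom_def)
qed

lemma atom_vars_rename:
  fixes a :: "('p, 'c) atom"
  shows "atom_vars (rename_atom f a) = f ` atom_vars a"
proof -
  have "term_vars (rename_term f t) = f ` term_vars t" for t :: "'c fo_term"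
    by (cases t) (auto simp: term_vars_def)
  then show ?thesis by (simp add: atom_vars_def rename_atom_def image_UN)
qed

lemma holds_rename:
  fixes F :: "('p, 'c) atom set"
  shows "holds I s (rename_atom f ` F) \<longleftrightarrow> holds I (s \<circ> f) F"
proof -
  have "term_val I s (rename_term f t) = term_val I (s \<circ> f) t" for t by (cases t) auto
  then have "map (term_val I s) (args (rename_atom f a)) = map (term_val I (s \<circ> f)) (args a)" for a :: "('p, 'c) atom"
    by (simp add: rename_atom_def)
  then show ?thesis by (simp add: holds_def rename_atom_def del: map_map)
qed

text \<open>Pairing a variable with the number \<open>e q\<close> of its query keeps the variables
  of different conjuncts apart when \<open>e\<close> is injective on \<open>T\<close>.\<close>

definition disjoint_conj :: "(('p, 'c) cq \<Rightarrow> nat) \<Rightarrow> ('p, 'c) cq set \<Rightarrow> ('p, 'c) cq" where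
  "disjoint_conj e T = (\<Union>q\<in>T. rename_atom (\<lambda>x. prod_encode (e q, x)) ` q)"

lemma sat_ex_disjoint_conj:
  assumes I: "is_interp I" and e: "inj_on e T"
  shows "sat_ex I (disjoint_conj e T) \<longleftrightarrow> (\<forall>q\<in>T. sat_ex I q)"
proof
  assume "sat_ex I (disjoint_conj e T)"
  then obtain s where s: "valuation I s" "holds I s (disjoint_conj e T)" by (auto simp: sat_ex_def)
  show "\<forall>q\<in>T. sat_ex I q"
  proof
    fix q assume "q \<in> T"
    then have "holds I s (rename_atom (\<lambda>x. prod_encode (e q, x)) ` q)"
      using s(2) by (auto simp: holds_def disjoint_conj_def)
    then have "holds I (s \<circ> (\<lambda>x. prod_encode (e q, x))) q" by (simp only: holds_rename)
    moreover have "valuation I (s \<circ> (\<lambda>x. prod_encode (e q, x)))" using s(1) by (auto simp: valuation_def)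
    ultimately show "sat_ex I q" unfolding sat_ex_def by blast
  qed
next
  assume "\<forall>q\<in>T. sat_ex I q"
  then obtain S where S: "\<And>q. q \<in> T \<Longrightarrow> valuation I (S q) \<and> holds I (S q) q"
    unfolding sat_ex_def by metis
  obtain d where d: "d \<in> universe I" using I by (auto simp: is_interp_def)
  \<comment> \<open>A variable is decoded to its query and its original name; \<open>d\<close> fills
    the codes that belong to no query in \<open>T\<close>.\<close>
  define s where "s z = (case prod_decode z of (i, x) \<Rightarrow>
    if i \<in> e ` T then S (inv_into T e i) x else d)" for z
  have "holds I s (rename_atom (\<lambda>x. prod_encode (e q, x)) ` q)" if "q \<in> T" for q
  proof -
    have "s \<circ> (\<lambda>x. prod_encode (e q, x)) = S q" using that e by (auto simp: s_def)
    then show ?thesis using S[OF that] by (simp add: holds_rename)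
  qed
  then have "holds I s (disjoint_conj e T)" by (fastforce simp: holds_def disjoint_conj_def)
  moreover have "S q x \<in> universe I" if "q \<in> T" for q x using S[OF that] by (auto simp: valuation_def)
  then have "valuation I s"
    using d by (auto simp: valuation_def s_def inv_into_into split: prod.splits)
  ultimately show "sat_ex I (disjoint_conj e T)" by (auto simp: sat_ex_def)
qed

section \<open>Finitely many small queries up to renaming\<close>

definition bounded_atoms :: "('p, 'c) signature \<Rightarrow> nat \<Rightarrow> ('p, 'c) atom set" where
  "bounded_atoms \<Sigma> K = {a. atom_over \<Sigma> a \<and> atom_vars a \<subseteq> {..<K}}"

lemma finite_bounded_atoms:
  assumes "finite_signature \<Sigma>"
  shows "finite (bounded_atoms \<Sigma> K)"
proof -
  let ?T = "Var ` {..<K} \<union> Const ` constants \<Sigma>"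
  have "a \<in> (\<Union>p\<in>preds \<Sigma>. Atom p ` {ts. set ts \<subseteq> ?T \<and> length ts = arity \<Sigma> p})"
    if a: "a \<in> bounded_atoms \<Sigma> K" for a
  proof -
    have "t \<in> ?T" if "t \<in> set (args a)" for t
      using a that
      by (cases t) (fastforce simp: bounded_atoms_def atom_over_def term_over_def atom_vars_def term_vars_def)+
    then have "args a \<in> {ts. set ts \<subseteq> ?T \<and> length ts = arity \<Sigma> (pred a)}" "pred a \<in> preds \<Sigma>"
      using a by (auto simp: bounded_atoms_def atom_over_def)
    then show ?thesis by (cases a) auto
  qed
  moreover have "finite (\<Union>p\<in>preds \<Sigma>. Atom p ` {ts. set ts \<subseteq> ?T \<and> length ts = arity \<Sigma> p})"
    using assms by (auto simp: finite_signature_def intro!: finite_lists_length_eq)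
  ultimately show ?thesis by (meson finite_subset subsetI)
qed

lemma card_vars_le:
  fixes A :: "('p, 'c) atom set"
  assumes "finite A" and "\<And>a. a \<in> A \<Longrightarrow> length (args a) \<le> m"
  shows "card (vars A) \<le> card A * m"
proof -
  have "card (atom_vars a) \<le> m" if "a \<in> A" for a
  proof -
    have "Var ` atom_vars a \<subseteq> set (args a)" by (auto simp: atom_vars_def term_vars_def)
    then have "card (Var ` atom_vars a :: 'c fo_term set) \<le> card (set (args a))" by (simp add: card_mono)
    also have "\<dots> \<le> m" using card_length assms(2)[OF that] order_trans by blast
    finally show ?thesis by (simp add: card_image inj_on_def)
  qed
  then have "(\<Sum>a\<in>A. card (atom_vars a)) \<le> card A * m" by (metis sum_bounded_above of_nat_id)
  then show ?thesis unfolding vars_def using card_UN_le[OF assms(1), of atom_vars] by linarith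
qed

text \<open>Any injection of the variables into \<open>{..<K}\<close> serves as \<open>f\<close>;
  its left inverse \<open>f'\<close> carries valuations of \<open>A\<close> over to the renamed
  copy.\<close>

lemma rename_into:
  assumes "finite A" "card (vars A) \<le> K"
  obtains f f' where "vars (rename_atom f ` A) \<subseteq> {..<K}" "\<And>x. x \<in> vars A \<Longrightarrow> f' (f x) = x"
proof -
  obtain f where f: "f ` vars A \<subseteq> {..<K}" "inj_on f (vars A)"
    using card_le_inj[of "vars A" "{..<K}"] assms finite_vars by auto
  show ?thesis
  proof (rule that[of f "inv_into (vars A) f"])
    show "vars (rename_atom f ` A) \<subseteq> {..<K}"
      using f(1) by (auto simp: vars_def atom_vars_rename)
  qed (use f(2) in auto)
qed

section \<open>Construction of the rewriting\<close>

theorem theorem7: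
  fixes \<Sigma> :: "('p, 'c) signature" and R :: "('p, 'c) erule set"
  assumes "finite_signature \<Sigma>"
    and "finite R"
    and "\<forall>r\<in>R. rule_over \<Sigma> r"
    and "\<forall>r\<in>R. connected_linear r"
  shows "fus \<Sigma> R"
  unfolding fus_def
proof (intro allI impI)
  fix Q assume Q: "ucq_over \<Sigma> Q"
  define N where "N = (\<Sum>r\<in>R. card (body r)) + (\<Sum>q\<in>Q. card q)"
  have NR: "\<forall>r\<in>R. card (body r) \<le> N"
    unfolding N_def using assms(2) by (auto intro: member_le_sum trans_le_add1)
  have NQ: "\<forall>q\<in>Q. card q \<le> N"
    unfolding N_def using Q by (auto simp: ucq_over_def intro: member_le_sum trans_le_add2)
  define m where "m = (\<Sum>p\<in>preds \<Sigma>. arity \<Sigma> p)"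
  have m: "length (args a) \<le> m" if "atom_over \<Sigma> a" for a :: "('p, 'c) atom"
    using that assms(1) unfolding m_def
    by (auto simp: atom_over_def finite_signature_def intro: member_le_sum)
  \<comment> \<open>At most \<open>N\<close> atoms have at most \<open>N * m\<close> variables, so
    every such query over the signature has a renamed copy in \<open>B\<close>.\<close>
  define B where "B = Pow (bounded_atoms \<Sigma> (N * m))"
  have finB: "finite B" by (simp add: B_def finite_bounded_atoms assms(1))
  define e where "e = to_nat_on B"
  have e: "inj_on e B" unfolding e_def by (rule inj_on_to_nat_on[OF countable_finite[OF finB]])
  \<comment> \<open>The entailment condition builds soundness into the definition; completeness is
    then left to locality.\<close>
  define Q' where "Q' = {q. \<exists>T\<subseteq>B. q = disjoint_conj e T \<and> entails R q Q}"
  have "finite Q'"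
    by (rule finite_subset[of _ "disjoint_conj e ` Pow B"]) (auto simp: Q'_def finB)
  moreover have over: "atoms_over \<Sigma> (disjoint_conj e T)" if "T \<subseteq> B" for T
  proof -
    have "finite q \<and> (\<forall>a\<in>q. atom_over \<Sigma> a)" if "q \<in> T" for q
    proof -
      have q: "q \<subseteq> bounded_atoms \<Sigma> (N * m)" using that \<open>T \<subseteq> B\<close> by (auto simp: B_def)
      then show ?thesis
        using finite_subset[OF q finite_bounded_atoms[OF assms(1)]] by (auto simp: bounded_atoms_def)
    qed
    then show ?thesis
      using finite_subset[OF that finB]
      by (auto simp: atoms_over_def disjoint_conj_def atom_over_rename)
  qed
  ultimately have "ucq_over \<Sigma> Q'" by (auto simp: ucq_over_def cq_over_def Q'_def)
  moreover have "complete_rewriting \<Sigma> R Q Q'"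
    unfolding complete_rewriting_def
  proof (intro allI impI iffI)
    fix D assume "entails {} D Q'"
    \<comment> \<open>Any model of \<open>R\<close> and \<open>D\<close> satisfies some disjunct of
      \<open>Q'\<close>, which together with \<open>R\<close> entails \<open>Q\<close>.\<close>
    then show "entails R D Q"
      unfolding entails_def Q'_def sat_ucq_def by blast
  next
    fix D assume D: "fact_base_over \<Sigma> D" and E: "entails R D Q"
    \<comment> \<open>All the patterns in \<open>B\<close> guaranteed by \<open>D\<close>; their
      disjoint conjunction is the disjunct of \<open>Q'\<close> that witnesses completeness for
      \<open>D\<close>.\<close>
    define T where "T = {q \<in> B. entails {} D {q}}"
    have TB: "T \<subseteq> B" by (auto simp: T_def)
    note conj = sat_ex_disjoint_conj[OF _ inj_on_subset[OF e TB]]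
    have "entails R (disjoint_conj e T) Q"
      unfolding entails_def
    proof (intro allI impI)
      fix M :: "(nat, 'p, 'c) interp"
      assume M: "is_interp M \<and> (\<forall>r\<in>R. sat_rule M r) \<and> sat_ex M (disjoint_conj e T)"
      \<comment> \<open>Locality asks for the small subsets of \<open>D\<close> in \<open>M\<close>;
        each has a renamed copy in \<open>T\<close>, hence a conjunct satisfied by
        \<open>M\<close>.\<close>
      have "sat_ex M A" if A: "A \<subseteq> D" "finite A" "card A \<le> N" for A
      proof -
        have Ao: "\<And>a. a \<in> A \<Longrightarrow> atom_over \<Sigma> a"
          using A(1) D by (auto simp: fact_base_over_def atoms_over_def)
        then have "card (vars A) \<le> card A * m" using card_vars_le[OF A(2)] m by blast
        also have "\<dots> \<le> N * m" using A(3) by simp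
        finally obtain f f' where f: "vars (rename_atom f ` A) \<subseteq> {..<N * m}"
          "\<And>x. x \<in> vars A \<Longrightarrow> f' (f x) = x"
          using rename_into[OF A(2)] by blast
        have "rename_atom f ` A \<in> B"
          using f(1) Ao by (auto simp: B_def bounded_atoms_def vars_def atom_over_rename)
        moreover have "sat_ex I (rename_atom f ` A)" if ID: "sat_ex I D" for I :: "(nat, 'p, 'c) interp"
        proof -
          obtain s where s: "valuation I s" "holds I s A"
            using ID A(1) by (auto simp: sat_ex_def holds_def)
          then have "holds I (s \<circ> f' \<circ> f) A"
            using holds_cong[of A s "s \<circ> f' \<circ> f" I] f(2) by auto
          then have "holds I (s \<circ> f') (rename_atom f ` A)" by (simp only: holds_rename)
          moreover have "valuation I (s \<circ> f')" using s(1) by (auto simp: valuation_def)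
          ultimately show ?thesis unfolding sat_ex_def by blast
        qed
        ultimately have "rename_atom f ` A \<in> T" by (auto simp: T_def entails_def sat_ucq_def)
        then have "sat_ex M (rename_atom f ` A)" using conj M by blast
        then obtain s where s: "valuation M s" "holds M (s \<circ> f) A"
          unfolding sat_ex_def holds_rename by blast
        then have "valuation M (s \<circ> f)" by (auto simp: valuation_def)
        then show ?thesis using s(2) unfolding sat_ex_def by blast
      qed
      then show "sat_ucq M Q"
        using locality[OF assms(1-3) D Q assms(4) NR NQ E] M by blast
    qed
    then have "disjoint_conj e T \<in> Q'" using TB by (auto simp: Q'_def)
    \<comment> \<open>Every member of \<open>T\<close> follows from \<open>D\<close>, and the
      conjuncts share no variables, so \<open>D\<close> entails the conjunction.\<close>
    moreover have "sat_ex I (disjoint_conj e T)" if "is_interp I" "sat_ex I D"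
      for I :: "(nat, 'p, 'c) interp"
      using that conj[of I] by (auto simp: T_def entails_def sat_ucq_def)
    ultimately show "entails {} D Q'" unfolding entails_def sat_ucq_def by blast
  qed
  ultimately show "\<exists>Q'. ucq_over \<Sigma> Q' \<and> complete_rewriting \<Sigma> R Q Q'" by blast
qed

end
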